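(* There are no non-trivial convergent sequences in $\beta\omega$: if $(V_n)_{n<\omega}$ is a sequence of points of $\beta\omega$ that converges to some point of $\beta\omega$, then $(V_n)$ is eventually constant.
   Context: $\omega$ is the set of natural numbers. A filter over a set $X$ is a family $F$ of subsets of $X$ such that $\emptyset\notin F$, $X\in F$, $F$ is closed under intersections of two members, and $F$ is closed under supersets in $X$; an ultrafilter over $X$ is a $\subseteq$-maximal filter over $X$. $\beta\omega$ is the set of all ultrafilters over $\omega$, with the topology having as a base the family of all cones $\langle A\rangle=\{U\in\beta\omega: A\in U\}$, $A\subseteq\omega$. A sequence converges to a point if every open neighbourhood of that point contains all but finitely many terms of the sequence. A sequence is trivial if it is eventually constant. *)

theory Defs
  imports "HOL-Analysis.Analysis"
begin

(* Filters are families of sets here. The library type "filter" is not used: it also contains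
   the improper filter, and set families are what the points of beta omega are. *)

definition filter_over :: "'a set \<Rightarrow> 'a set set \<Rightarrow> bool" where
  "filter_over X F \<longleftrightarrow>
     F \<subseteq> Pow X \<and> {} \<notin> F \<and> X \<in> F \<and>
     (\<forall>A\<in>F. \<forall>B\<in>F. A \<inter> B \<in> F) \<and>
     (\<forall>A\<in>F. \<forall>B. A \<subseteq> B \<and> B \<subseteq> X \<longrightarrow> B \<in> F)"

definition ultrafilter_over :: "'a set \<Rightarrow> 'a set set \<Rightarrow> bool" where
  "ultrafilter_over X U \<longleftrightarrow>
     filter_over X U \<and> (\<forall>F. filter_over X F \<and> U \<subseteq> F \<longrightarrow> F = U)"

definition beta_omega :: "nat set set set" where
  "beta_omega = {U. ultrafilter_over (UNIV :: nat set) U}"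

definition cone :: "nat set \<Rightarrow> nat set set set" where
  "cone A = {U \<in> beta_omega. A \<in> U}"

(* The open sets are the unions of families of cones; "topology" is only meaningful on
   predicates satisfying istopology, which is proved below. *)
definition beta_omega_topology :: "nat set set topology" where
  "beta_omega_topology = topology (arbitrary union_of (\<lambda>S. S \<in> range cone))"

lemma cone_Int: "cone A \<inter> cone B = cone (A \<inter> B)"
proof -
  have "A \<inter> B \<in> U \<longleftrightarrow> A \<in> U \<and> B \<in> U" if "U \<in> beta_omega" for U
  proof -
    have "filter_over UNIV U"
      using that by (simp add: beta_omega_def ultrafilter_over_def)
    then show ?thesis
      unfolding filter_over_def by (meson Int_lower1 Int_lower2 subset_UNIV)
  qed
  then show ?thesis by (auto simp: cone_def)
qed

lemma openin_beta_omega_topology: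
  "openin beta_omega_topology = arbitrary union_of (\<lambda>S. S \<in> range cone)"
  unfolding beta_omega_topology_def
  by (intro topology_inverse' istopology_base) (auto simp: cone_Int)

lemma topspace_beta_omega_topology: "topspace beta_omega_topology = beta_omega"
proof
  show "topspace beta_omega_topology \<subseteq> beta_omega"
    unfolding topspace_def openin_beta_omega_topology
    by (auto simp: union_of_def arbitrary_def cone_def)
  have "cone UNIV = beta_omega"
    by (auto simp: cone_def beta_omega_def ultrafilter_over_def filter_over_def)
  moreover have "openin beta_omega_topology (cone UNIV)"
    unfolding openin_beta_omega_topology by (simp add: arbitrary_union_of_inc)
  ultimately show "beta_omega \<subseteq> topspace beta_omega_topology"
    by (metis openin_subset)
qed

definition eventually_constant :: "(nat \<Rightarrow> 'a) \<Rightarrow> bool" where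
  "eventually_constant f \<longleftrightarrow> (\<exists>c. \<forall>\<^sub>F n in sequentially. f n = c)"

end

theory Submission
  imports Defs
begin

text \<open>Otherwise infinitely many \<open>V n\<close> differ from the limit \<open>W\<close>. A set of \<open>W\<close> lying outside
  such a \<open>V n\<close> is a member of all later terms, so one can shrink \<open>UNIV\<close> to a descending sequence
  of members \<open>B k\<close> of \<open>W\<close> whose differences \<open>B k - B (Suc k)\<close> belong to the terms of a
  subsequence. These differences are disjoint, and the union of the even ones lies in every
  other term of the subsequence, whereas convergence to an ultrafilter decides each set eventually.\<close>

lemma filter_over_UNIV:
  assumes "filter_over UNIV U"
  shows filter_over_empty: "{} \<notin> U"
    and filter_over_UNIV_mem: "UNIV \<in> U"
    and filter_over_Int: "A \<in> U \<Longrightarrow> B \<in> U \<Longrightarrow> A \<inter> B \<in> U"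
    and filter_over_superset: "A \<in> U \<Longrightarrow> A \<subseteq> B \<Longrightarrow> B \<in> U"
  using assms by (simp_all add: filter_over_def)

text \<open>Both sets cannot be members, as their intersection is empty. If \<open>A\<close> is not
  a member, \<open>U\<close> and \<open>- A\<close> together generate a proper filter, which by
  maximality is \<open>U\<close> itself.\<close>

lemma ultrafilter_over_Compl_iff:
  assumes "ultrafilter_over UNIV U"
  shows "- A \<in> U \<longleftrightarrow> A \<notin> U"
proof
  have filt: "filter_over UNIV U"
    using assms by (simp add: ultrafilter_over_def)
  note U = filter_over_UNIV[OF filt]
  show "A \<notin> U" if "- A \<in> U"
    using U(1) U(3)[OF that] by force
  show "- A \<in> U" if "A \<notin> U"
  proof -
    define F where "F = {C. \<exists>B\<in>U. B - A \<subseteq> C}"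
    \<comment> \<open>\<open>B - A \<subseteq> {}\<close> would make \<open>A\<close> a superset of
      the member \<open>B\<close>, hence itself a member.\<close>
    have "{} \<notin> F"
      using U(4) that by (auto simp: F_def)
    moreover have "C \<inter> D \<in> F" if CD: "C \<in> F" "D \<in> F" for C D
    proof -
      obtain B B' where "B \<in> U" "B - A \<subseteq> C" "B' \<in> U" "B' - A \<subseteq> D"
        using CD by (auto simp: F_def)
      then have "B \<inter> B' \<in> U" "B \<inter> B' - A \<subseteq> C \<inter> D"
        using U(3) by auto
      then show ?thesis
        unfolding F_def by blast
    qed
    moreover have "UNIV \<in> F" "\<And>C D. C \<in> F \<Longrightarrow> C \<subseteq> D \<Longrightarrow> D \<in> F"
      using U(2) by (auto simp: F_def)
    ultimately have "filter_over UNIV F"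
      by (simp add: filter_over_def)
    moreover have "U \<subseteq> F"
      by (auto simp: F_def)
    ultimately have "F = U"
      using assms by (simp add: ultrafilter_over_def)
    moreover have "- A \<in> F"
      unfolding F_def using U(2) by auto
    ultimately show ?thesis
      by simp
  qed
qed

lemma ultrafilter_over_subset_imp_eq:
  assumes "ultrafilter_over X U" "ultrafilter_over X W" "W \<subseteq> U"
  shows "U = W"
  using assms by (simp add: ultrafilter_over_def)

text \<open>The cone of \<open>A\<close> is an open neighbourhood of \<open>W\<close>. Convergence
  enters the main proof only in this form.\<close>

lemma limitin_beta_omega_eventually_mem:
  assumes "limitin beta_omega_topology V W F" and "A \<in> W"
  shows "\<forall>\<^sub>F n in F. A \<in> V n"
proof -
  have "openin beta_omega_topology (cone A)"
    unfolding openin_beta_omega_topology by (simp add: arbitrary_union_of_inc)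
  moreover have "W \<in> cone A"
    using assms by (auto simp: limitin_def topspace_beta_omega_topology cone_def)
  ultimately have "\<forall>\<^sub>F n in F. V n \<in> cone A"
    using assms(1) by (simp add: limitin_def)
  then show ?thesis
    by (rule eventually_mono) (simp add: cone_def)
qed

text \<open>The difference with the larger index lies inside the set that the earlier difference has
  removed.\<close>

lemma decseq_differences_disjoint:
  fixes B :: "nat \<Rightarrow> 'a set"
  assumes "decseq B" and "i \<noteq> j"
  shows "(B i - B (Suc i)) \<inter> (B j - B (Suc j)) = {}"
proof (cases "i < j")
  case True
  then show ?thesis
    using decseqD[OF assms(1), of "Suc i" j] by auto
next
  case False
  then show ?thesis
    using decseqD[OF assms(1), of "Suc j" i] assms(2) by auto
qed

theorem theorem3p2p3:
  fixes V :: "nat \<Rightarrow> nat set set" and W :: "nat set set"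
  assumes "\<And>n. V n \<in> beta_omega"
    and "W \<in> beta_omega"
    and "limitin beta_omega_topology V W sequentially"
  shows "eventually_constant V"
proof (rule ccontr)
  assume nonconst: "\<not> eventually_constant V"
  have ultraV: "ultrafilter_over UNIV (V n)" for n
    using assms(1) by (simp add: beta_omega_def)
  have ultraW: "ultrafilter_over UNIV W"
    using assms(2) by (simp add: beta_omega_def)
  have filtV: "filter_over UNIV (V n)" for n
    using ultraV by (simp add: ultrafilter_over_def)
  have filtW: "filter_over UNIV W"
    using ultraW by (simp add: ultrafilter_over_def)
  note evW = limitin_beta_omega_eventually_mem[OF assms(3)]

  \<comment> \<open>Dependent choice runs on pairs: a member of \<open>W\<close> and the index of a
    term containing the piece just cut off. Increasing indices yield a subsequence.\<close>
  have "\<exists>x. fst x \<in> W"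
    using filter_over_UNIV_mem[OF filtW] by auto
  moreover have "\<exists>y. fst y \<in> W \<and> (fst y \<subseteq> fst x \<and> snd x < snd y \<and> fst x - fst y \<in> V (snd y))"
    if x: "fst x \<in> W" for x :: "nat set \<times> nat"
  proof -
    \<comment> \<open>Non-constancy is applied to the candidate value \<open>W\<close>.\<close>
    have "\<exists>\<^sub>F n in sequentially. V n \<noteq> W"
      using nonconst by (auto simp: eventually_constant_def frequently_def)
    moreover have "\<forall>\<^sub>F n in sequentially. fst x \<in> V n \<and> snd x < n"
      using evW[OF x] eventually_gt_at_top by (rule eventually_conj)
    ultimately have "\<exists>\<^sub>F n in sequentially. (fst x \<in> V n \<and> snd x < n) \<and> V n \<noteq> W"
      by (rule frequently_eventually_conj)
    then obtain n where n: "V n \<noteq> W" "fst x \<in> V n" "snd x < n"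
      using frequently_ex by blast
    \<comment> \<open>By maximality, distinct ultrafilters are incomparable, so the separating set
      can be taken from \<open>W\<close>.\<close>
    obtain A where A: "A \<in> W" "A \<notin> V n"
      using ultrafilter_over_subset_imp_eq[OF ultraV ultraW] n(1) by blast
    \<comment> \<open>The next set is \<open>fst x \<inter> A\<close>, still in \<open>W\<close>;
      the part removed is in \<open>V n\<close>.\<close>
    have "fst x \<inter> - A \<in> V n"
      using filter_over_Int[OF filtV n(2)] A(2) by (simp add: ultrafilter_over_Compl_iff[OF ultraV])
    moreover have "fst x \<inter> - A = fst x - fst x \<inter> A"
      by auto
    ultimately show ?thesis
      using filter_over_Int[OF filtW x A(1)] n(3) by (intro exI[of _ "(fst x \<inter> A, n)"]) auto
  qed
  ultimately obtain f :: "nat \<Rightarrow> nat set \<times> nat" where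
    f: "\<And>k. fst (f (Suc k)) \<subseteq> fst (f k)" "\<And>k. snd (f k) < snd (f (Suc k))"
       "\<And>k. fst (f k) - fst (f (Suc k)) \<in> V (snd (f (Suc k)))"
    using dependent_nat_choice[of "\<lambda>_ x. fst x \<in> W"
        "\<lambda>_ x y. fst y \<subseteq> fst x \<and> snd x < snd y \<and> fst x - fst y \<in> V (snd y)"]
    by blast
  define B where "B k = fst (f k)" for k
  \<comment> \<open>The shift is needed because the piece between \<open>B k\<close> and
    \<open>B (Suc k)\<close> belongs to the term chosen together with
    \<open>B (Suc k)\<close>.\<close>
  define r where "r k = snd (f (Suc k))" for k
  define D where "D k = B k - B (Suc k)" for k
  define E where "E = (\<Union>k. D (2 * k))"
  have "decseq B"
    using f(1) by (simp add: decseq_Suc_iff B_def)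
  then have disj: "D i \<inter> D j = {}" if "i \<noteq> j" for i j
    unfolding D_def using that by (rule decseq_differences_disjoint)
  have "strict_mono r"
    using f(2) by (simp add: strict_mono_Suc_iff r_def)
  have D_mem: "D k \<in> V (r k)" for k
    using f(3) by (simp add: D_def B_def r_def)
  have even: "E \<in> V (r (2 * k))" for k
    by (rule filter_over_superset[OF filtV D_mem]) (auto simp: E_def)
  have odd: "- E \<in> V (r (2 * k + 1))" for k
  proof -
    have "D (2 * k + 1) \<inter> D (2 * j) = {}" for j
      by (rule disj) presburger
    then have "D (2 * k + 1) \<subseteq> - E"
      by (auto simp: E_def)
    then show ?thesis
      by (rule filter_over_superset[OF filtV D_mem])
  qed
  \<comment> \<open>A strictly increasing \<open>r\<close> satisfies \<open>k \<le> r k\<close>, so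
    positions of either parity occur beyond any threshold.\<close>
  have late: "n \<le> r k" if "n \<le> k" for n k
    using seq_suble[OF \<open>strict_mono r\<close>, of k] that by simp
  show False
  proof (cases "E \<in> W")
    case True
    then obtain n where "\<And>m. n \<le> m \<Longrightarrow> E \<in> V m"
      using evW by (auto simp: eventually_sequentially)
    \<comment> \<open>An odd position past the threshold, where \<open>- E\<close> is a member too;
      the other case uses an even one.\<close>
    then have "E \<in> V (r (2 * n + 1))"
      using late by simp
    then show False
      using odd[of n] by (simp add: ultrafilter_over_Compl_iff[OF ultraV])
  next
    case False
    then have "- E \<in> W"
      by (simp add: ultrafilter_over_Compl_iff[OF ultraW])
    then obtain n where "\<And>m. n \<le> m \<Longrightarrow> - E \<in> V m"
      using evW by (auto simp: eventually_sequentially)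
    then have "- E \<in> V (r (2 * n))"
      using late by simp
    then show False
      using even[of n] by (simp add: ultrafilter_over_Compl_iff[OF ultraV])
  qed
qed

end
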